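(* Let $\hat{\mathbf Q}\in\hat{\mathbb Q}^{n\times n}$ be a dual quaternion Hermitian matrix, let $\{\hat\lambda_i\}_{i=1}^n$ be its eigenvalues (counted with multiplicity) and $\{\hat{\mathbf v}^i\}_{i=1}^n$ corresponding eigenvectors, and let $\hat P=\mathcal J(\hat{\mathbf Q})\in\mathbb{DC}^{2n\times 2n}$. Then $$\{\hat\lambda_1,\hat\lambda_1,\hat\lambda_2,\hat\lambda_2,\dots,\hat\lambda_n,\hat\lambda_n\}$$ consists (counted with multiplicity) of all the eigenvalues of $\hat P$. Moreover, for each $i$, $\mathcal F(\hat{\mathbf v}^i)$ and $\mathcal F(\hat{\mathbf v}^i\mathbf j)$ are two orthogonal eigenvectors of $\hat P$ with respect to the eigenvalue $\hat\lambda_i$. Conversely, if $\hat{\mathbf u}^i\in\mathbb{DC}^{2n\times1}$ is an eigenvector of $\hat P$ corresponding to the eigenvalue $\hat\lambda_i$, then $\mathcal F^{-1}(\hat{\mathbf u}^i)$ is an eigenvector of $\hat{\mathbf Q}$ associated with the same eigenvalue $\hat\lambda_i$.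
   Context: $\varepsilon$ is the infinitesimal unit: $\varepsilon\ne0$, $\varepsilon^2=0$, commuting with complex numbers and quaternions. $\mathbb D=\{a_{st}+a_{\mathcal I}\varepsilon:a_{st},a_{\mathcal I}\in\mathbb R\}$ are the dual numbers, $\mathbb{DC}$ the dual complex numbers (same with $\mathbb C$), $\mathbb Q$ the real quaternions with units $\mathbf i,\mathbf j,\mathbf k$, and $\hat{\mathbb Q}=\{\tilde p_{st}+\tilde p_{\mathcal I}\varepsilon:\tilde p_{st},\tilde p_{\mathcal I}\in\mathbb Q\}$ the dual quaternions; $\mathbb C=\mathbb R+\mathbb R\mathbf i\subset\mathbb Q$. $^*$ is the conjugate transpose; a square matrix is Hermitian if it equals its conjugate transpose. A vector is appreciable if its standard part (the part without $\varepsilon$) is nonzero. Eigenvalues and eigenvectors: for $\hat P\in\mathbb{DC}^{m\times m}$, $\hat\lambda\in\mathbb{DC}$ is an eigenvalue with eigenvector $\hat{\mathbf x}\in\mathbb{DC}^{m\times1}$ if $\hat{\mathbf x}$ is appreciable and $\hat P\hat{\mathbf x}=\hat{\mathbf x}\hat\lambda$. For $\hat{\mathbf Q}\in\hat{\mathbb Q}^{n\times n}$, a dual number $\hat\lambda\in\mathbb D$ is an eigenvalue with eigenvector $\hat{\mathbf x}\in\hat{\mathbb Q}^{n\times 1}$ if $\hat{\mathbf x}$ is appreciable and $\hat{\mathbf Q}\hat{\mathbf x}=\hat{\mathbf x}\hat\lambda$. Known facts: a dual quaternion Hermitian matrix of dimension $n$ has exactly $n$ eigenvalues counted with multiplicity,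 all dual numbers, which are the diagonal entries of $\hat\Sigma$ in a unitary decomposition $\hat{\mathbf Q}=\hat{\mathbf U}^*\hat\Sigma\hat{\mathbf U}$ ($\hat{\mathbf U}$ unitary dual quaternion, $\hat\Sigma$ diagonal with dual number entries); likewise a dual complex Hermitian matrix of dimension $m$ has exactly $m$ dual number eigenvalues counted with multiplicity. Two vectors $\hat{\mathbf x},\hat{\mathbf y}$ are orthogonal if $\hat{\mathbf x}^*\hat{\mathbf y}=\hat0$. Every $\hat{\mathbf Q}\in\hat{\mathbb Q}^{m\times n}$ is uniquely $(A_1+A_2\mathbf j)+(A_3+A_4\mathbf j)\varepsilon$ with $A_i\in\mathbb C^{m\times n}$, and $$\mathcal J(\hat{\mathbf Q})=\begin{bmatrix}A_1&A_2\\-\overline{A_2}&\overline{A_1}\end{bmatrix}+\begin{bmatrix}A_3&A_4\\-\overline{A_4}&\overline{A_3}\end{bmatrix}\varepsilon .$$ The bijection $\mathcal F:\hat{\mathbb Q}^{n\times1}\to\mathbb{DC}^{2n\times1}$ is, for $\mathbf v_i\in\mathbb C^{n\times1}$, $$\mathcal F(\mathbf v_1+\mathbf v_2\mathbf j+(\mathbf v_3+\mathbf v_4\mathbf j)\varepsilon)=\begin{bmatrix}\mathbf v_1\\-\overline{\mathbf v_2}\end{bmatrix}+\begin{bmatrix}\mathbf v_3\\-\overline{\mathbf v_4}\end{bmatrix}\varepsilon .$$ *)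

theory Defs
  imports "HOL-Analysis.Analysis"
begin

section \<open>Rings with conjugation\<close>

class star_ring = ring_1 +
  fixes star :: "'a \<Rightarrow> 'a"
  assumes star_add: "star (x + y) = star x + star y"
    and star_mult: "star (x * y) = star y * star x"
    and star_star: "star (star x) = x"

instantiation complex :: star_ring
begin
definition star_complex :: "complex \<Rightarrow> complex" where "star_complex = cnj"
instance by standard (auto simp: star_complex_def)
end


section \<open>Real quaternions\<close>

text \<open>\<open>Quat a b c d\<close> stands for \<open>a + b i + c j + d k\<close>.\<close>

datatype quat = Quat (q_re: real) (q_i: real) (q_j: real) (q_k: real)

instantiation quat :: real_algebra_1
begin

definition "0 = Quat 0 0 0 0"
definition "1 = Quat 1 0 0 0"
definition "p + q = Quat (q_re p + q_re q) (q_i p + q_i q) (q_j p + q_j q) (q_k p + q_k q)"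
definition "- p = Quat (- q_re p) (- q_i p) (- q_j p) (- q_k p)"
definition "p - q = Quat (q_re p - q_re q) (q_i p - q_i q) (q_j p - q_j q) (q_k p - q_k q)"
definition "p * q = Quat
  (q_re p * q_re q - q_i p * q_i q - q_j p * q_j q - q_k p * q_k q)
  (q_re p * q_i q + q_i p * q_re q + q_j p * q_k q - q_k p * q_j q)
  (q_re p * q_j q - q_i p * q_k q + q_j p * q_re q + q_k p * q_i q)
  (q_re p * q_k q + q_i p * q_j q - q_j p * q_i q + q_k p * q_re q)"
definition "r *\<^sub>R p = Quat (r * q_re p) (r * q_i p) (r * q_j p) (r * q_k p)"

lemmas quat_ops = zero_quat_def one_quat_def plus_quat_def uminus_quat_def minus_quat_def
  times_quat_def scaleR_quat_def

instance by standard (simp_all add: quat_ops quat.expand algebra_simps)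

end

instantiation quat :: star_ring
begin
definition star_quat :: "quat \<Rightarrow> quat" where
  "star_quat q = Quat (q_re q) (- q_i q) (- q_j q) (- q_k q)"
instance by standard (simp_all add: star_quat_def quat_ops quat.expand algebra_simps)
end

definition quat_I :: quat where "quat_I = Quat 0 1 0 0"
definition quat_J :: quat where "quat_J = Quat 0 0 1 0"
definition quat_K :: quat where "quat_K = Quat 0 0 0 1"

lemma quat_units:
  "quat_I * quat_I = - 1" "quat_J * quat_J = - 1" "quat_K * quat_K = - 1"
  "quat_I * quat_J * quat_K = - 1"
  by (simp_all add: quat_ops quat_I_def quat_J_def quat_K_def)

definition quat_of_complex :: "complex \<Rightarrow> quat" where
  "quat_of_complex z = Quat (Re z) (Im z) 0 0"

text \<open>The components in the unique decomposition \<open>q = a + b j\<close> with complex \<open>a\<close>, \<open>b\<close>.\<close>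

definition cpart1 :: "quat \<Rightarrow> complex" where "cpart1 q = Complex (q_re q) (q_i q)"
definition cpart2 :: "quat \<Rightarrow> complex" where "cpart2 q = Complex (q_j q) (q_k q)"

lemma quat_complex_decomp:
  "q = quat_of_complex a + quat_of_complex b * quat_J \<longleftrightarrow> a = cpart1 q \<and> b = cpart2 q"
  by (cases q) (auto simp: quat_of_complex_def quat_J_def cpart1_def cpart2_def quat_ops complex_eq_iff)


section \<open>Dual numbers over a ring\<close>

text \<open>\<open>Dual a b\<close> stands for \<open>a + b \<epsilon>\<close>. The dual numbers, dual complex numbers and dual
  quaternions are the instances at \<^typ>\<open>real\<close>, \<^typ>\<open>complex\<close> and \<^typ>\<open>quat\<close>.\<close>

datatype 'a dualnum = Dual (st_part: 'a) (inf_part: 'a)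

instantiation dualnum :: (ring_1) ring_1
begin

definition "0 = Dual 0 0"
definition "1 = Dual 1 0"
definition "x + y = Dual (st_part x + st_part y) (inf_part x + inf_part y)"
definition "- x = Dual (- st_part x) (- inf_part x)"
definition "x - y = Dual (st_part x - st_part y) (inf_part x - inf_part y)"
definition "x * y = Dual (st_part x * st_part y) (st_part x * inf_part y + inf_part x * st_part y)"

lemmas dualnum_ops = zero_dualnum_def one_dualnum_def plus_dualnum_def uminus_dualnum_def
  minus_dualnum_def times_dualnum_def

instance by standard (simp_all add: dualnum_ops dualnum.expand algebra_simps)

end

instance dualnum :: (comm_ring_1) comm_ring_1
  by standard (simp_all add: dualnum_ops algebra_simps)

instantiation dualnum :: (star_ring) star_ring
begin
definition star_dualnum :: "'a dualnum \<Rightarrow> 'a dualnum" where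
  "star_dualnum = map_dualnum star"
instance
  by standard (simp_all add: star_dualnum_def dualnum_ops dualnum.map_sel dualnum.expand
    star_add star_mult star_star add.commute)
end

definition dual_eps :: "'a::ring_1 dualnum" where "dual_eps = Dual 0 1"

lemma dual_eps:
  "dual_eps \<noteq> (0 :: 'a::ring_1 dualnum)"
  "dual_eps * dual_eps = (0 :: 'a::ring_1 dualnum)"
  "x * dual_eps = dual_eps * (x :: 'a::ring_1 dualnum)"
  "Dual a b = Dual a 0 + Dual b 0 * dual_eps"
  by (simp_all add: dual_eps_def dualnum_ops)

definition of_dual_real :: "real dualnum \<Rightarrow> 'a::real_algebra_1 dualnum" where
  "of_dual_real = map_dualnum of_real"


section \<open>Matrices, eigenvectors and eigenvalues\<close>

definition conj_transpose :: "'a::star_ring^'n^'m \<Rightarrow> 'a^'m^'n" where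
  "conj_transpose A = (\<chi> i j. star (A $ j $ i))"

definition hermitian :: "'a::star_ring^'n^'n \<Rightarrow> bool" where
  "hermitian A \<longleftrightarrow> conj_transpose A = A"

definition unitary :: "'a::star_ring^'n^'n \<Rightarrow> bool" where
  "unitary U \<longleftrightarrow> conj_transpose U ** U = mat 1 \<and> U ** conj_transpose U = mat 1"

definition diag_matrix :: "('n \<Rightarrow> 'a::zero) \<Rightarrow> 'a^'n^'n" where
  "diag_matrix d = (\<chi> i j. if i = j then d i else 0)"

text \<open>Scalars act on vectors from the right (unlike in \<open>(*s)\<close>).\<close>

definition vec_scale_right :: "'a::ring_1^'n \<Rightarrow> 'a \<Rightarrow> 'a^'n" where
  "vec_scale_right x c = (\<chi> i. x $ i * c)"

definition star_orthogonal :: "'a::star_ring^'n \<Rightarrow> 'a^'n \<Rightarrow> bool" where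
  "star_orthogonal x y \<longleftrightarrow> (\<Sum>i\<in>UNIV. star (x $ i) * y $ i) = 0"

definition st_vec :: "'a dualnum^'n \<Rightarrow> 'a^'n" where
  "st_vec x = (\<chi> i. st_part (x $ i))"

definition inf_vec :: "'a dualnum^'n \<Rightarrow> 'a^'n" where
  "inf_vec x = (\<chi> i. inf_part (x $ i))"

definition appreciable :: "'a::zero dualnum^'n \<Rightarrow> bool" where
  "appreciable x \<longleftrightarrow> st_vec x \<noteq> 0"

definition is_eigenvector :: "'a::ring_1 dualnum^'n^'n \<Rightarrow> 'a dualnum \<Rightarrow> 'a dualnum^'n \<Rightarrow> bool" where
  "is_eigenvector A c x \<longleftrightarrow> appreciable x \<and> A *v x = vec_scale_right x c"

text \<open>\<open>M\<close> is the multiset of eigenvalues of \<open>A\<close>, counted with multiplicity: the diagonal entries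
  of \<open>\<Sigma>\<close> in a decomposition \<open>A = U\<^sup>* \<Sigma> U\<close> with \<open>U\<close> unitary and \<open>\<Sigma>\<close> diagonal with dual
  number entries.\<close>

definition eigenvalues_with_multiplicity ::
  "'a::{star_ring,real_algebra_1} dualnum^'n^'n \<Rightarrow> real dualnum multiset \<Rightarrow> bool" where
  "eigenvalues_with_multiplicity A M \<longleftrightarrow>
    (\<exists>U d. unitary U \<and> A = conj_transpose U ** diag_matrix (\<lambda>i. of_dual_real (d i)) ** U \<and>
      M = image_mset d (mset_set UNIV))"


section \<open>The maps \<open>\<J>\<close> and \<open>\<F>\<close>\<close>

text \<open>Block rows and columns are indexed by a sum type: \<open>Inl\<close> is the first block,
  \<open>Inr\<close> the second.\<close>

definition quat_matrix_to_complex :: "quat^'n^'m \<Rightarrow> complex^('n + 'n)^('m + 'm)" where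
  "quat_matrix_to_complex A = (\<chi> r s.
    (case r of
      Inl i \<Rightarrow> (case s of Inl j \<Rightarrow> cpart1 (A $ i $ j) | Inr j \<Rightarrow> cpart2 (A $ i $ j))
    | Inr i \<Rightarrow> (case s of Inl j \<Rightarrow> - cnj (cpart2 (A $ i $ j)) | Inr j \<Rightarrow> cnj (cpart1 (A $ i $ j)))))"

definition quat_vec_to_complex :: "quat^'n \<Rightarrow> complex^('n + 'n)" where
  "quat_vec_to_complex x = (\<chi> r.
    (case r of Inl i \<Rightarrow> cpart1 (x $ i) | Inr i \<Rightarrow> - cnj (cpart2 (x $ i))))"

definition J_map :: "quat dualnum^'n^'m \<Rightarrow> complex dualnum^('n + 'n)^('m + 'm)" where
  "J_map Q = (\<chi> r s. Dual (quat_matrix_to_complex (\<chi> i j. st_part (Q $ i $ j)) $ r $ s)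
                          (quat_matrix_to_complex (\<chi> i j. inf_part (Q $ i $ j)) $ r $ s))"

definition F_map :: "quat dualnum^'n \<Rightarrow> complex dualnum^('n + 'n)" where
  "F_map x = (\<chi> r. Dual (quat_vec_to_complex (st_vec x) $ r) (quat_vec_to_complex (inf_vec x) $ r))"

lemma bij_F_map: "bij (F_map :: quat dualnum^'n \<Rightarrow> complex dualnum^('n + 'n))"
proof (rule o_bij)
  let ?c = "\<lambda>a b. Quat (Re a) (Im a) (- Re b) (Im b)"
  let ?G = "\<lambda>u :: complex dualnum^('n + 'n). (\<chi> i.
     Dual (?c (st_part (u $ Inl i)) (st_part (u $ Inr i)))
          (?c (inf_part (u $ Inl i)) (inf_part (u $ Inr i)))) :: quat dualnum^'n"
  note defs = F_map_def quat_vec_to_complex_def st_vec_def inf_vec_def cpart1_def cpart2_def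
  show "?G \<circ> F_map = id"
    by (auto simp: fun_eq_iff vec_eq_iff defs)
  show "F_map \<circ> ?G = id"
    by (auto simp: fun_eq_iff vec_eq_iff defs complex_eq_iff dualnum.expand split: sum.split)
qed

end

theory Submission
  imports Defs
begin

text \<open>
  The whole correspondence rests on two algebraic facts. First,
  \<open>\<J>\<close> is a unital \<open>*\<close>-homomorphism from dual quaternion to dual complex matrices
  (\<open>J_map_mult\<close>, \<open>J_map_conj_transpose\<close>, \<open>J_map_one\<close>), because \<open>a + b j \<mapsto> [a, b; -b\<^sup>*, a\<^sup>*]\<close> is the
  usual embedding of the quaternions. Secondly, \<open>\<F>(x)\<close> is the first column of \<open>\<J>(x)\<close>, so that
  \<open>\<F>(Q x) = \<J>(Q) \<F>(x)\<close> (\<open>F_map_matrix_vector\<close>). Since dual real numbers are central and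
  \<open>\<F>\<close> is a bijection that preserves appreciability, \<open>x\<close> is an eigenvector of \<open>Q\<close> if and only
  if \<open>\<F>(x)\<close> is one of \<open>\<J>(Q)\<close>; and \<open>x j\<close> is an eigenvector together with \<open>x\<close>.

  Applying \<open>\<J>\<close> to a unitary decomposition \<open>Q = U\<^sup>* \<Sigma> U\<close> gives one of \<open>\<J>(Q)\<close> in which every
  diagonal entry of \<open>\<Sigma>\<close> occurs twice. What remains is that a dual complex matrix has at most one
  multiset of eigenvalues. The characteristic polynomial cannot show this, because polynomials
  over the dual numbers do not factor uniquely: \<open>(x - \<epsilon>) (x + \<epsilon>) = x\<^sup>2\<close>. Instead, compare two
  decompositions \<open>U\<^sup>* D U = V\<^sup>* E V\<close> through \<open>W = V U\<^sup>*\<close>, which satisfies \<open>W D = E W\<close>, i.e.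
  \<open>w\<^sub>i\<^sub>j d\<^sub>j = e\<^sub>i w\<^sub>i\<^sub>j\<close>. Hence \<open>d\<^sub>j = e\<^sub>i\<close> wherever \<open>w\<^sub>i\<^sub>j\<close> has a nonzero standard part. The
  standard part of \<open>W\<close> is invertible, so some term in the Leibniz expansion of its determinant
  is nonzero, and this term is a permutation that matches the \<open>d\<^sub>j\<close> with the \<open>e\<^sub>i\<close>
  (\<open>eigenvalues_with_multiplicity_unique\<close>).
\<close>

section \<open>Dual numbers and their conjugation\<close>

lemma star_zero [simp]: "star (0::'a::star_ring) = 0"
  using star_add[of 0 "0::'a"] by simp

lemma star_minus: "star (- x :: 'a::star_ring) = - star x"
proof -
  have "star x + star (- x) = 0"
    by (simp flip: star_add)
  then show ?thesis
    by (simp add: eq_neg_iff_add_eq_0 add.commute)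
qed

lemma star_diff: "star (x - y :: 'a::star_ring) = star x - star y"
  using star_add[of x "- y"] by (simp add: star_minus)

lemma star_sum: "star (sum f A :: 'a::star_ring) = (\<Sum>i\<in>A. star (f i))"
  by (induction A rule: infinite_finite_induct) (simp_all add: star_add)

lemma st_part_simps [simp]:
  "st_part (0 :: 'a::ring_1 dualnum) = 0"
  "st_part (1 :: 'a::ring_1 dualnum) = 1"
  "st_part (x * y :: 'a::ring_1 dualnum) = st_part x * st_part y"
  by (simp_all add: dualnum_ops)

lemma st_part_sum: "st_part (sum f A :: 'a::ring_1 dualnum) = (\<Sum>i\<in>A. st_part (f i))"
  by (induction A rule: infinite_finite_induct) (simp_all add: dualnum_ops)

text \<open>Dual numbers have zero divisors, but all of them are infinitesimal.\<close>

lemma appreciable_mult_eq_0: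
  fixes x y :: "'a::ring_1_no_zero_divisors dualnum"
  assumes "st_part x \<noteq> 0" "x * y = 0"
  shows "y = 0"
  using assms by (cases x; cases y) (auto simp: dualnum_ops)

lemma of_dual_real_inject:
  "(of_dual_real a :: 'a::real_algebra_1 dualnum) = of_dual_real b \<longleftrightarrow> a = b"
  by (cases a; cases b) (simp add: of_dual_real_def)

lemma of_dual_real_commute: "x * of_dual_real a = of_dual_real a * (x :: 'a::real_algebra_1 dualnum)"
  by (cases a; cases x)
    (simp add: of_dual_real_def dualnum_ops of_real_def add.commute)

section \<open>Eigenvalues of unitarily diagonalized dual complex matrices\<close>

lemma matrix_mult_diag_matrix: "(A ** diag_matrix d) $ i $ j = A $ i $ j * (d j :: 'a::semiring_1)"
  by (simp add: matrix_matrix_mult_def diag_matrix_def if_distrib[of "\<lambda>x. y * x" for y] cong: if_cong)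

lemma diag_matrix_mult: "(diag_matrix d ** A) $ i $ j = d i * (A $ i $ j :: 'a::semiring_1)"
  by (simp add: matrix_matrix_mult_def diag_matrix_def if_distrib[of "\<lambda>x. x * y" for y] cong: if_cong)

lemma diag_matrix_mult_vec: "(diag_matrix d *v x) $ i = d i * (x $ i :: 'a::semiring_1)"
  by (simp add: matrix_vector_mult_def diag_matrix_def if_distrib[of "\<lambda>x. x * y" for y] cong: if_cong)

lemma matrix_mult_vec_scale_right:
  "A *v vec_scale_right x c = vec_scale_right (A *v x) (c :: 'a::ring_1)"
  by (simp add: matrix_vector_mult_def vec_scale_right_def vec_eq_iff sum_distrib_right mult.assoc)

text \<open>Taking standard parts is a ring homomorphism, so it preserves invertibility of matrices.
  Then some term of the determinant of the standard part does not vanish.\<close>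

lemma invertible_dual_matrix_appreciable_permutation:
  fixes W W' :: "'a::field dualnum^'n^'n"
  assumes "W ** W' = mat 1"
  obtains p where "p permutes UNIV" "\<And>i. st_part (W $ i $ p i) \<noteq> 0"
proof -
  define S :: "'a dualnum^'n^'n \<Rightarrow> 'a^'n^'n" where "S = (\<lambda>A. \<chi> i j. st_part (A $ i $ j))"
  have "S W ** S W' = S (W ** W')"
    by (simp add: S_def matrix_matrix_mult_def vec_eq_iff st_part_sum)
  also have "\<dots> = mat 1"
    by (simp add: assms S_def mat_def vec_eq_iff)
  finally have "det (S W) * det (S W') = 1"
    by (metis det_mul det_I)
  then have "det (S W) \<noteq> 0" by auto
  then obtain p where p: "p permutes UNIV" "of_int (sign p) * (\<Prod>i\<in>UNIV. S W $ i $ p i) \<noteq> 0"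
    unfolding det_def by (metis (mono_tags, lifting) mem_Collect_eq sum.neutral)
  then have "st_part (W $ i $ p i) \<noteq> 0" for i
    by (auto simp: S_def)
  with p(1) that show thesis by blast
qed

lemma eigenvalues_with_multiplicity_unique:
  fixes A :: "complex dualnum^'n^'n"
  assumes "eigenvalues_with_multiplicity A M" "eigenvalues_with_multiplicity A N"
  shows "M = N"
proof -
  define D :: "('n \<Rightarrow> real dualnum) \<Rightarrow> complex dualnum^'n^'n"
    where "D d = diag_matrix (\<lambda>i. of_dual_real (d i))" for d
  obtain U d where U: "unitary U" "A = conj_transpose U ** D d ** U"
    and M: "M = image_mset d (mset_set UNIV)"
    using assms(1) unfolding eigenvalues_with_multiplicity_def D_def by blast
  obtain V e where V: "unitary V" "A = conj_transpose V ** D e ** V"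
    and N: "N = image_mset e (mset_set UNIV)"
    using assms(2) unfolding eigenvalues_with_multiplicity_def D_def by blast
  define W where "W = V ** conj_transpose U"
  have U1: "U ** conj_transpose U = mat 1" "conj_transpose U ** U = mat 1"
    and V1: "V ** conj_transpose V = mat 1"
    using U(1) V(1) by (auto simp: unitary_def)
  have "W ** (U ** conj_transpose V) = V ** (conj_transpose U ** U) ** conj_transpose V"
    by (simp add: W_def matrix_mul_assoc)
  then have "W ** (U ** conj_transpose V) = mat 1"
    by (simp add: U1 V1)
  then obtain p where p: "p permutes UNIV" "\<And>i. st_part (W $ i $ p i) \<noteq> 0"
    using invertible_dual_matrix_appreciable_permutation by blast
  have "W ** D d = V ** (conj_transpose U ** D d ** U) ** conj_transpose U"
    by (metis W_def U1(1) matrix_mul_assoc matrix_mul_rid)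
  also have "\<dots> = V ** (conj_transpose V ** D e ** V) ** conj_transpose U"
    using U(2) V(2) by simp
  also have "\<dots> = D e ** W"
    by (metis W_def V1 matrix_mul_assoc matrix_mul_lid)
  finally have WD: "W ** D d = D e ** W" .
  have "d (p i) = e i" for i
  proof -
    have "W $ i $ p i * of_dual_real (d (p i)) = of_dual_real (e i) * W $ i $ p i"
      using WD by (metis D_def matrix_mult_diag_matrix diag_matrix_mult)
    then have "W $ i $ p i * (of_dual_real (d (p i)) - of_dual_real (e i)) = 0"
      by (simp add: algebra_simps)
    then have "of_dual_real (d (p i)) - of_dual_real (e i) = (0 :: complex dualnum)"
      using appreciable_mult_eq_0 p(2) by blast
    then show ?thesis
      by (simp add: of_dual_real_inject)
  qed
  then have "N = image_mset d (image_mset p (mset_set UNIV))"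
    unfolding N by (simp add: multiset.map_comp o_def)
  also have "image_mset p (mset_set UNIV) = mset_set (UNIV :: 'n set)"
    using p(1) by (simp add: image_mset_mset_set permutes_inj permutes_surj)
  finally show ?thesis
    by (simp add: M)
qed

text \<open>In the coordinates \<open>y = U x\<close> the eigenvalue equation is \<open>d\<^sub>i y\<^sub>i = y\<^sub>i c\<close>, which forces
  \<open>c = d\<^sub>i\<close> at any appreciable coordinate. So all eigenvalues are dual real numbers, although
  \<open>c\<close> ranges over the dual complex numbers.\<close>

lemma eigenvalue_in_eigenvalues_with_multiplicity:
  fixes A :: "complex dualnum^'n^'n"
  assumes "eigenvalues_with_multiplicity A M" "is_eigenvector A c x"
  shows "\<exists>a\<in>#M. c = of_dual_real a"
proof -
  obtain U and d :: "'n \<Rightarrow> real dualnum"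
    where U: "unitary U" "A = conj_transpose U ** diag_matrix (\<lambda>i. of_dual_real (d i)) ** U"
    and M: "M = image_mset d (mset_set UNIV)"
    using assms(1) unfolding eigenvalues_with_multiplicity_def by blast
  define y where "y = U *v x"
  have U1: "U ** conj_transpose U = mat 1" "conj_transpose U ** U = mat 1"
    using U(1) by (auto simp: unitary_def)
  have "diag_matrix (\<lambda>i. of_dual_real (d i)) *v y = U *v (A *v x)"
    by (simp add: U(2) y_def matrix_vector_mul_assoc matrix_mul_assoc U1)
  also have "\<dots> = vec_scale_right y c"
    using assms(2) by (simp add: is_eigenvector_def y_def matrix_mult_vec_scale_right)
  finally have y: "of_dual_real (d i) * y $ i = y $ i * c" for i
    by (metis diag_matrix_mult_vec vec_scale_right_def vec_lambda_beta)
  have "\<exists>i. st_part (y $ i) \<noteq> 0"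
  proof (rule ccontr)
    assume "\<nexists>i. st_part (y $ i) \<noteq> 0"
    then have "st_vec (conj_transpose U *v y) = 0"
      by (simp add: st_vec_def vec_eq_iff matrix_vector_mult_def st_part_sum)
    moreover have "conj_transpose U *v y = x"
      by (simp add: y_def matrix_vector_mul_assoc U1)
    ultimately show False
      using assms(2) by (simp add: is_eigenvector_def appreciable_def)
  qed
  then obtain i where i: "st_part (y $ i) \<noteq> 0" by blast
  have "y $ i * (c - of_dual_real (d i)) = 0"
    using y[of i] by (simp add: algebra_simps)
  then have "c = of_dual_real (d i)"
    using appreciable_mult_eq_0[OF i] by force
  then show ?thesis
    by (auto simp: M)
qed

section \<open>Complex components of dual quaternions\<close>

definition dpart1 :: "quat dualnum \<Rightarrow> complex dualnum" where
  "dpart1 = map_dualnum cpart1"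

definition dpart2 :: "quat dualnum \<Rightarrow> complex dualnum" where
  "dpart2 = map_dualnum cpart2"

lemmas dpart_unfold = dpart1_def dpart2_def cpart1_def cpart2_def dualnum_ops quat_ops
  star_dualnum_def star_complex_def star_quat_def dualnum.map_sel complex_eq_iff dualnum.expand

text \<open>The product rules restate \<open>j b = b\<^sup>* j\<close> for complex \<open>b\<close>.\<close>

lemma dpart_mult:
  "dpart1 (p * q) = dpart1 p * dpart1 q - dpart2 p * star (dpart2 q)"
  "dpart2 (p * q) = dpart1 p * dpart2 q + dpart2 p * star (dpart1 q)"
  by (simp_all add: dpart_unfold algebra_simps)

lemma dpart_zero: "dpart1 0 = 0" "dpart2 0 = 0"
  by (simp_all add: dpart_unfold)

lemma dpart_one: "dpart1 1 = 1" "dpart2 1 = 0"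
  by (simp_all add: dpart_unfold)

lemma dpart_add: "dpart1 (p + q) = dpart1 p + dpart1 q" "dpart2 (p + q) = dpart2 p + dpart2 q"
  by (simp_all add: dpart_unfold)

lemma dpart_sum:
  "dpart1 (sum f A) = (\<Sum>i\<in>A. dpart1 (f i))" "dpart2 (sum f A) = (\<Sum>i\<in>A. dpart2 (f i))"
  by (induction A rule: infinite_finite_induct) (simp_all add: dpart_zero dpart_add)

lemma dpart_star: "dpart1 (star q) = star (dpart1 q)" "dpart2 (star q) = - dpart2 q"
  by (simp_all add: dpart_unfold)

lemma dpart_of_dual_real: "dpart1 (of_dual_real a) = of_dual_real a" "dpart2 (of_dual_real a) = 0"
  by (simp_all add: dpart_unfold of_dual_real_def of_real_def)

lemma dpart_J: "dpart1 (Dual quat_J 0) = 0" "dpart2 (Dual quat_J 0) = 1"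
  by (simp_all add: dpart_unfold quat_J_def)

lemma star_of_dual_real: "star (of_dual_real a) = (of_dual_real a :: complex dualnum)"
  by (simp add: dpart_unfold of_dual_real_def)

lemma star_one_dual_complex: "star 1 = (1 :: complex dualnum)"
  by (simp add: dpart_unfold)

section \<open>The embedding of dual quaternion matrices and vectors\<close>

lemma J_map_nth:
  "J_map A $ Inl i $ Inl j = dpart1 (A $ i $ j)"
  "J_map A $ Inl i $ Inr j = dpart2 (A $ i $ j)"
  "J_map A $ Inr i $ Inl j = - star (dpart2 (A $ i $ j))"
  "J_map A $ Inr i $ Inr j = star (dpart1 (A $ i $ j))"
  by (simp_all add: J_map_def quat_matrix_to_complex_def dpart1_def dpart2_def dualnum.expand
      dualnum.map_sel star_dualnum_def star_complex_def dualnum_ops)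

lemma F_map_nth:
  "F_map x $ Inl i = dpart1 (x $ i)"
  "F_map x $ Inr i = - star (dpart2 (x $ i))"
  by (simp_all add: F_map_def quat_vec_to_complex_def st_vec_def inf_vec_def dpart1_def dpart2_def
      dualnum.expand dualnum.map_sel star_dualnum_def star_complex_def dualnum_ops)

lemma sum_UNIV_sum_type:
  fixes f :: "'a::finite + 'b::finite \<Rightarrow> 'c::comm_monoid_add"
  shows "sum f UNIV = (\<Sum>i\<in>UNIV. f (Inl i)) + (\<Sum>i\<in>UNIV. f (Inr i))"
  unfolding UNIV_Plus_UNIV[symmetric] by (subst sum.Plus) (simp_all add: comp_def)

lemma vec_eq_sum_type_iff:
  "x = y \<longleftrightarrow> (\<forall>i. x $ Inl i = y $ Inl i) \<and> (\<forall>i. x $ Inr i = y $ Inr i)"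
  for x y :: "'c^('a::finite + 'b::finite)"
  by (metis vec_eq_iff sum.exhaust)

lemmas J_map_expand = vec_eq_sum_type_iff J_map_nth F_map_nth sum_UNIV_sum_type dpart_mult dpart_sum
  star_sum star_add star_diff star_minus star_mult star_star sum_negf sum_subtractf sum.distrib

lemma J_map_mult: "J_map (A ** B) = J_map A ** J_map B"
  by (simp add: matrix_matrix_mult_def J_map_expand algebra_simps)

lemma J_map_conj_transpose: "J_map (conj_transpose A) = conj_transpose (J_map A)"
  by (simp add: conj_transpose_def J_map_expand dpart_star)

lemma J_map_one: "J_map (mat 1 :: quat dualnum^'n^'n) = mat 1"
  by (simp add: mat_def J_map_expand dpart_one dpart_zero star_one_dual_complex)

lemma J_map_diag_matrix:
  "J_map (diag_matrix (\<lambda>i. of_dual_real (d i))) = diag_matrix (\<lambda>r. of_dual_real (case_sum d d r))"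
  by (simp add: diag_matrix_def J_map_expand dpart_of_dual_real dpart_zero star_of_dual_real)

lemma F_map_matrix_vector: "F_map (A *v x) = J_map A *v F_map x"
  by (simp add: matrix_vector_mult_def J_map_expand algebra_simps)

lemma F_map_scale_dual_real:
  "F_map (vec_scale_right x (of_dual_real a)) = vec_scale_right (F_map x) (of_dual_real a)"
  by (simp add: vec_scale_right_def J_map_expand dpart_of_dual_real star_of_dual_real mult.commute)

lemma appreciable_F_map: "appreciable (F_map x) \<longleftrightarrow> appreciable x"
proof -
  have "cpart1 q = 0 \<and> cpart2 q = 0 \<longleftrightarrow> q = 0" for q
    by (cases q) (auto simp: cpart1_def cpart2_def quat_ops complex_eq_iff)
  then show ?thesis
    unfolding appreciable_def
    by (simp add: vec_eq_sum_type_iff st_vec_def F_map_def quat_vec_to_complex_def)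
      (simp add: vec_eq_iff, blast)
qed

section \<open>Transfer of eigenvalues and eigenvectors\<close>

lemma is_eigenvector_F_map_iff:
  "is_eigenvector (J_map Q) (of_dual_real a) (F_map x) \<longleftrightarrow> is_eigenvector Q (of_dual_real a) x"
  by (simp add: is_eigenvector_def appreciable_F_map inj_eq[OF bij_is_inj[OF bij_F_map]]
      flip: F_map_matrix_vector F_map_scale_dual_real)

text \<open>Right multiplication by \<open>j\<close> commutes with the left action of the matrix and with the
  central scalar, and it loses no information because \<open>j\<close> is a unit.\<close>

lemma is_eigenvector_scale_J:
  assumes "is_eigenvector Q (of_dual_real a) x"
  shows "is_eigenvector Q (of_dual_real a) (vec_scale_right x (Dual quat_J 0))"
proof -
  have "q * quat_J = 0 \<longleftrightarrow> q = 0" for q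
    by (cases q) (auto simp: quat_J_def quat_ops)
  then have "appreciable (vec_scale_right x (Dual quat_J 0)) \<longleftrightarrow> appreciable x"
    by (simp add: appreciable_def st_vec_def vec_scale_right_def vec_eq_iff)
  moreover have "vec_scale_right (vec_scale_right x (of_dual_real a)) (Dual quat_J 0)
      = vec_scale_right (vec_scale_right x (Dual quat_J 0)) (of_dual_real a)"
    by (simp add: vec_scale_right_def mult.assoc of_dual_real_commute)
  ultimately show ?thesis
    using assms by (simp add: is_eigenvector_def matrix_mult_vec_scale_right)
qed

text \<open>For \<open>x = a + b j\<close> one has \<open>x j = -b + a j\<close>, so the two blocks contribute
  \<open>-a\<^sup>* b\<close> and \<open>b a\<^sup>*\<close> to the inner product.\<close>

lemma star_orthogonal_F_map_scale_J:
  "star_orthogonal (F_map x) (F_map (vec_scale_right x (Dual quat_J 0)))"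
  by (simp add: star_orthogonal_def vec_scale_right_def J_map_expand dpart_J star_one_dual_complex
      mult.commute)

lemma eigenvalues_with_multiplicity_J_map:
  assumes "eigenvalues_with_multiplicity Q M"
  shows "eigenvalues_with_multiplicity (J_map Q) (M + M)"
proof -
  obtain U d where U: "unitary U"
      "Q = conj_transpose U ** diag_matrix (\<lambda>i. of_dual_real (d i)) ** U"
    and M: "M = image_mset d (mset_set UNIV)"
    using assms unfolding eigenvalues_with_multiplicity_def by blast
  have "unitary (J_map U)"
    using U(1) by (simp add: unitary_def J_map_one flip: J_map_conj_transpose J_map_mult)
  moreover have "J_map Q = conj_transpose (J_map U)
      ** diag_matrix (\<lambda>r. of_dual_real (case_sum d d r)) ** J_map U"
    by (simp add: U(2) J_map_mult J_map_conj_transpose J_map_diag_matrix)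
  moreover have "M + M = image_mset (case_sum d d) (mset_set UNIV)"
  proof -
    have "mset_set (UNIV :: ('a + 'a) set) = mset_set (range Inl \<union> range Inr)"
      by (simp add: UNIV_sum)
    also have "\<dots> = image_mset Inl (mset_set UNIV) + image_mset Inr (mset_set UNIV)"
      by (subst mset_set_Union) (auto simp: image_mset_mset_set)
    finally show ?thesis
      by (simp add: M multiset.map_comp comp_def)
  qed
  ultimately show ?thesis
    unfolding eigenvalues_with_multiplicity_def by blast
qed

lemma sum_double_mset: "(\<Sum>i\<in>A. {#f i, f i#}) = image_mset f (mset_set A) + image_mset f (mset_set A)"
  by (induction A rule: infinite_finite_induct) simp_all

theorem corollary1:
  fixes Q :: "quat dualnum^'n^'n"
    and ev :: "'n \<Rightarrow> real dualnum"
    and v :: "'n \<Rightarrow> quat dualnum^'n"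
  assumes herm: "hermitian Q"
    and eigenvalues: "eigenvalues_with_multiplicity Q (image_mset ev (mset_set UNIV))"
    and eigenvectors: "\<And>i. is_eigenvector Q (of_dual_real (ev i)) (v i)"
  shows "(\<forall>M. eigenvalues_with_multiplicity (J_map Q) M \<longleftrightarrow> M = (\<Sum>i\<in>UNIV. {#ev i, ev i#}))
    \<and> (\<forall>c :: complex dualnum.
        (\<exists>x. is_eigenvector (J_map Q) c x) \<longleftrightarrow> (\<exists>i. c = of_dual_real (ev i)))
    \<and> (\<forall>i. is_eigenvector (J_map Q) (of_dual_real (ev i)) (F_map (v i))
         \<and> is_eigenvector (J_map Q) (of_dual_real (ev i))
             (F_map (vec_scale_right (v i) (Dual quat_J 0)))
         \<and> star_orthogonal (F_map (v i)) (F_map (vec_scale_right (v i) (Dual quat_J 0))))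
    \<and> (\<forall>i u. is_eigenvector (J_map Q) (of_dual_real (ev i)) u \<longrightarrow>
         is_eigenvector Q (of_dual_real (ev i)) (inv F_map u))"
proof -
  have mult: "eigenvalues_with_multiplicity (J_map Q) (\<Sum>i\<in>UNIV. {#ev i, ev i#})"
    using eigenvalues_with_multiplicity_J_map[OF eigenvalues] by (simp add: sum_double_mset)
  have "\<forall>M. eigenvalues_with_multiplicity (J_map Q) M \<longleftrightarrow> M = (\<Sum>i\<in>UNIV. {#ev i, ev i#})"
    using mult eigenvalues_with_multiplicity_unique by blast
  moreover have "\<exists>i. c = of_dual_real (ev i)" if "is_eigenvector (J_map Q) c x" for c x
    using eigenvalue_in_eigenvalues_with_multiplicity[OF mult that] by (auto simp: sum_double_mset)
  moreover have "is_eigenvector (J_map Q) (of_dual_real (ev i)) (F_map (v i))"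
    "is_eigenvector (J_map Q) (of_dual_real (ev i)) (F_map (vec_scale_right (v i) (Dual quat_J 0)))"
    for i
    by (simp_all add: is_eigenvector_F_map_iff eigenvectors is_eigenvector_scale_J)
  moreover have "is_eigenvector Q (of_dual_real (ev i)) (inv F_map u)"
    if "is_eigenvector (J_map Q) (of_dual_real (ev i)) u" for i u
    using that by (metis is_eigenvector_F_map_iff bij_F_map bij_is_surj surj_f_inv_f)
  ultimately show ?thesis
    using star_orthogonal_F_map_scale_J by blast
qed

end
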